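(* Let $\mathcal{P}_{\lambda}$ be the set of Borel probability measures $P$ on $[0,1]^3$ whose projections (push-forwards) onto the coordinate planes $xy$, $xz$ and $yz$ are all equal to the two-dimensional Lebesgue measure on $[0,1]^2$. Let $\lambda$ denote Lebesgue measure on $[0,1]$ and $\oplus$ the bitwise addition on $[0,1]$. (1) The image of the two-dimensional Lebesgue measure $\lambda(dx)\times\lambda(dy)$ on $[0,1]^2$ under the mapping $(x,y)\mapsto (x,y,1-x\oplus y)$ belongs to $\mathcal{P}_\lambda$ and is a solution to the maximization problem $$\max_{P\in\mathcal{P}_\lambda}\int_{[0,1]^3} xyz\,dP .$$ (2) The image of $\lambda(dx)\times\lambda(dy)$ under the mapping $(x,y)\mapsto (x,y,x\oplus y)$ belongs to $\mathcal{P}_\lambda$ and is a solution to the minimization problem $$\min_{P\in\mathcal{P}_\lambda}\int_{[0,1]^3} xyz\,dP .$$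
   Context: Bitwise addition (xor): for $x,y\in[0,1]$ with binary expansions $x=\sum_{i\ge1}x_i2^{-i}$, $y=\sum_{i\ge1}y_i2^{-i}$, $x_i,y_i\in\{0,1\}$, one sets $x\oplus y=\sum_{i\ge1}\big((x_i+y_i)\bmod 2\big)2^{-i}$. Convention: every dyadic rational number less than $1$ is written with finitely many digits equal to $1$, and $1$ is written as $0.1111\ldots$ (all digits equal to $1$). The expression $1-x\oplus y$ means $1-(x\oplus y)$. *)

theory Defs
  imports "HOL-Probability.Probability"
begin

definition dyadic :: "real \<Rightarrow> bool" where
  "dyadic x \<longleftrightarrow> (\<exists>(m::int) (n::nat). x = of_int m / 2 ^ n)"

text \<open>
  Digit sequences are indexed from 0, so \<open>d i\<close> is the digit of weight \<open>2 ^ -(i + 1)\<close>.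
  The last two conditions fix the choice between the two expansions of a dyadic rational:
  the finite one below 1, and \<open>0.1111...\<close> for 1 itself.
\<close>
definition binary_expansion :: "real \<Rightarrow> (nat \<Rightarrow> nat) \<Rightarrow> bool" where
  "binary_expansion x d \<longleftrightarrow>
     (\<forall>i. d i \<in> {0, 1}) \<and>
     (\<lambda>i. real (d i) / 2 ^ Suc i) sums x \<and>
     (dyadic x \<and> x < 1 \<longrightarrow> finite {i. d i = 1}) \<and>
     (x = 1 \<longrightarrow> (\<forall>i. d i = 1))"

definition binary_digits :: "real \<Rightarrow> nat \<Rightarrow> nat" where
  "binary_digits x = (THE d. binary_expansion x d)"

definition bitwise_add :: "real \<Rightarrow> real \<Rightarrow> real" (infixl "\<oplus>\<^sub>2" 65) where
  "x \<oplus>\<^sub>2 y = (\<Sum>i. real ((binary_digits x i + binary_digits y i) mod 2) / 2 ^ Suc i)"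

abbreviation unit_lebesgue :: "real measure" where
  "unit_lebesgue \<equiv> restrict_space lborel {0..1}"

abbreviation square_lebesgue :: "(real \<times> real) measure" where
  "square_lebesgue \<equiv> unit_lebesgue \<Otimes>\<^sub>M unit_lebesgue"

abbreviation cube_borel :: "(real \<times> real \<times> real) measure" where
  "cube_borel \<equiv> restrict_space borel ({0..1} \<times> {0..1} \<times> {0..1})"

definition P_lambda :: "(real \<times> real \<times> real) measure set" where
  "P_lambda = {P. prob_space P \<and> sets P = sets cube_borel \<and>
     distr P square_lebesgue (\<lambda>(x, y, z). (x, y)) = square_lebesgue \<and>
     distr P square_lebesgue (\<lambda>(x, y, z). (x, z)) = square_lebesgue \<and>
     distr P square_lebesgue (\<lambda>(x, y, z). (y, z)) = square_lebesgue}"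

lemma digit_tail:
  fixes d :: "nat \<Rightarrow> nat"
  assumes d: "\<And>i. d i \<in> {0, 1}" and s: "(\<lambda>i. real (d i) / 2 ^ Suc i) sums x"
  obtains t where "(\<lambda>i. real (d (i + n)) / 2 ^ Suc i) sums t" "0 \<le> t" "t \<le> 1"
    "(\<forall>i\<ge>n. d i = 1) \<or> t < 1"
    "2 ^ n * x = real (\<Sum>i<n. d i * 2 ^ (n - Suc i)) + t"
proof -
  let ?f = "\<lambda>i. real (d i) / 2 ^ Suc i"
  let ?g = "\<lambda>i. real (d (i + n)) / 2 ^ Suc i"
  let ?t = "2 ^ n * (x - (\<Sum>i<n. ?f i))"
  have "(\<lambda>i. ?f (i + n)) sums (x - (\<Sum>i<n. ?f i))"
    using s sums_iff_shift'[of ?f n x] by simp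
  then have "(\<lambda>i. 2 ^ n * ?f (i + n)) sums ?t" by (rule sums_mult)
  then have t: "?g sums ?t" by (simp add: power_add field_simps)
  have g1: "(\<lambda>i. 1 / 2 ^ Suc i :: real) sums 1" using power_half_series by (simp add: power_one_over)
  have le: "?g i \<le> 1 / 2 ^ Suc i" for i using d[of "i + n"] by (auto simp: field_simps)
  have "0 \<le> ?t" using t by (intro sums_le[OF _ sums_zero t]) auto
  moreover have "?t \<le> 1" by (rule sums_le[OF le t g1])
  moreover have "(\<forall>i\<ge>n. d i = 1) \<or> ?t < 1"
  proof (cases "\<forall>i\<ge>n. d i = 1")
    case False
    then obtain j where j: "d (j + n) = 0" using d by (metis insertE le_add_diff_inverse2 singletonD)
    have "(\<lambda>i. 1 / 2 ^ Suc i - ?g i) sums (1 - ?t)" by (rule sums_diff[OF g1 t])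
    moreover have "0 < (\<Sum>i. 1 / 2 ^ Suc i - ?g i)"
    proof (rule suminf_pos2[where i = j])
      show "summable (\<lambda>i. 1 / 2 ^ Suc i - ?g i)" using calculation by (rule sums_summable)
      show "0 \<le> 1 / 2 ^ Suc i - ?g i" for i using le[of i] by simp
      show "0 < 1 / 2 ^ Suc j - ?g j" using j by simp
    qed
    ultimately show ?thesis by (simp add: sums_iff)
  qed simp
  moreover have "2 ^ n * x = real (\<Sum>i<n. d i * 2 ^ (n - Suc i)) + ?t"
  proof -
    have "2 ^ n * (\<Sum>i<n. ?f i) = (\<Sum>i<n. real (d i * 2 ^ (n - Suc i)))"
      unfolding sum_distrib_left
    proof (rule sum.cong)
      fix i assume "i \<in> {..<n}"
      then have "(2::real) ^ n = 2 ^ Suc i * 2 ^ (n - Suc i)" by (simp flip: power_add power_Suc)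
      then show "2 ^ n * ?f i = real (d i * 2 ^ (n - Suc i))" by simp
    qed simp
    then show ?thesis by (simp add: algebra_simps)
  qed
  ultimately show thesis using t that by blast
qed

lemma binary_expansion_floor:
  assumes "binary_expansion x d" "x < 1"
  shows "int (d i) = \<lfloor>2 ^ Suc i * x\<rfloor> mod 2"
proof -
  have d: "\<And>i. d i \<in> {0, 1}" and s: "(\<lambda>i. real (d i) / 2 ^ Suc i) sums x"
    and fin: "dyadic x \<Longrightarrow> finite {i. d i = 1}"
    using assms unfolding binary_expansion_def by simp_all
  obtain t where t: "(\<lambda>j. real (d (j + Suc i)) / 2 ^ Suc j) sums t" "0 \<le> t"
      "(\<forall>j\<ge>Suc i. d j = 1) \<or> t < 1"
      "2 ^ Suc i * x = real (\<Sum>j<Suc i. d j * 2 ^ (Suc i - Suc j)) + t"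
    by (rule digit_tail[OF d s, of "Suc i"])
  have "t < 1"
  proof (rule ccontr)
    assume "\<not> t < 1"
    then have one: "\<forall>j\<ge>Suc i. d j = 1" using t by blast
    have "(\<lambda>j. 1 / 2 ^ Suc j :: real) sums 1" using power_half_series by (simp add: power_one_over)
    moreover have "(\<lambda>j. real (d (j + Suc i)) / 2 ^ Suc j) = (\<lambda>j. 1 / 2 ^ Suc j)"
      using one by (intro ext) simp
    ultimately have "t = 1" using t(1) by (simp only:) (rule sums_unique2)
    then have "x = of_int (int (\<Sum>j<Suc i. d j * 2 ^ (Suc i - Suc j)) + 1) / 2 ^ Suc i"
      using t(4) by (simp add: field_simps)
    then have "dyadic x" unfolding dyadic_def by blast
    then have "finite {i. d i = 1}" by (rule fin)
    moreover have "{Suc i..} \<subseteq> {i. d i = 1}" using one by auto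
    ultimately show False using infinite_Ici finite_subset by blast
  qed
  then have "\<lfloor>2 ^ Suc i * x\<rfloor> = int (\<Sum>j<Suc i. d j * 2 ^ (Suc i - Suc j))"
    using t by linarith
  moreover have "(\<Sum>j<Suc i. d j * 2 ^ (Suc i - Suc j)) mod 2 = d i mod 2"
  proof -
    have "2 dvd (\<Sum>j<i. d j * 2 ^ (i - j))" by (intro dvd_sum) auto
    then show ?thesis by (auto simp: mod_eq_0_iff_dvd elim!: dvdE)
  qed
  moreover have "d i mod 2 = d i" using d[of i] by auto
  ultimately show ?thesis by (metis of_nat_mod of_nat_numeral)
qed

lemma binary_expansion_floor_digits:
  assumes "0 \<le> x" "x < 1"
  shows "binary_expansion x (\<lambda>i. nat (\<lfloor>2 ^ Suc i * x\<rfloor> mod 2))"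
proof -
  let ?d = "\<lambda>i. nat (\<lfloor>2 ^ Suc i * x\<rfloor> mod 2)"
  have dig: "real (?d i) = of_int \<lfloor>2 ^ Suc i * x\<rfloor> - 2 * of_int \<lfloor>2 ^ i * x\<rfloor>" for i
  proof -
    have "\<lfloor>2 ^ Suc i * x\<rfloor> div 2 = \<lfloor>2 ^ i * x\<rfloor>"
      using floor_divide_real_eq_div[of 2 "2 ^ Suc i * x"] by simp
    then have "\<lfloor>2 ^ Suc i * x\<rfloor> mod 2 = \<lfloor>2 ^ Suc i * x\<rfloor> - 2 * \<lfloor>2 ^ i * x\<rfloor>"
      by (metis minus_mult_div_eq_mod)
    then show ?thesis by simp
  qed
  have part: "(\<Sum>i<n. real (?d i) / 2 ^ Suc i) = of_int \<lfloor>2 ^ n * x\<rfloor> / 2 ^ n" for n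
  proof (induction n)
    case 0
    then show ?case using assms by (simp add: floor_eq_iff)
  next
    case (Suc n)
    then show ?case by (simp only: sum.lessThan_Suc dig) (simp add: field_simps)
  qed
  have lim: "(\<lambda>n. of_int \<lfloor>2 ^ n * x\<rfloor> / 2 ^ n) \<longlonglongrightarrow> x"
  proof (rule tendsto_sandwich)
    show "\<forall>\<^sub>F n in sequentially. x - (1/2) ^ n \<le> of_int \<lfloor>2 ^ n * x\<rfloor> / 2 ^ n"
    proof (intro always_eventually allI)
      fix n
      have "2 ^ n * x - 1 \<le> of_int \<lfloor>2 ^ n * x\<rfloor>" by linarith
      then show "x - (1/2) ^ n \<le> of_int \<lfloor>2 ^ n * x\<rfloor> / 2 ^ n"
        unfolding power_one_over by (simp add: le_divide_eq left_diff_distrib right_diff_distrib mult.commute)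
    qed
    show "\<forall>\<^sub>F n in sequentially. of_int \<lfloor>2 ^ n * x\<rfloor> / 2 ^ n \<le> x"
      by (intro always_eventually allI) (simp add: divide_le_eq mult.commute)
    have "(\<lambda>n. x - (1/2) ^ n) \<longlonglongrightarrow> x - 0"
      by (intro tendsto_diff tendsto_const LIMSEQ_power_zero) simp
    then show "(\<lambda>n. x - (1/2) ^ n) \<longlonglongrightarrow> x" by simp
  qed simp
  have "(\<lambda>i. real (?d i) / 2 ^ Suc i) sums x" unfolding sums_def part by (rule lim)
  moreover have "finite {i. ?d i = 1}" if dy: "dyadic x"
  proof -
    obtain m :: int and n where x: "x = of_int m / 2 ^ n" using dy unfolding dyadic_def by blast
    have "?d i = 0" if "n \<le> i" for i
    proof -
      have "(2::real) ^ Suc i = 2 ^ n * (2 * 2 ^ (i - n))"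
        using that by (simp flip: power_add power_Suc)
      then have "2 ^ Suc i * x = of_int (2 * (2 ^ (i - n) * m))" unfolding x by simp
      then have "\<lfloor>2 ^ Suc i * x\<rfloor> = 2 * (2 ^ (i - n) * m)" by (metis floor_of_int)
      then show ?thesis by simp
    qed
    then have "{i. ?d i = 1} \<subseteq> {..<n}" by (auto simp: not_le[symmetric])
    then show ?thesis using finite_subset by blast
  qed
  moreover have "?d i \<in> {0, 1}" for i by (auto simp: nat_eq_iff)
  ultimately show ?thesis using assms unfolding binary_expansion_def by auto
qed

lemma binary_expansion_one: "binary_expansion 1 d \<longleftrightarrow> d = (\<lambda>_. 1)"
  using power_half_series by (auto simp: binary_expansion_def power_one_over)

text \<open>Every point of the unit interval has exactly one expansion in the above
  sense, so the definite description in \<open>binary_digits\<close> is proper there.\<close>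

lemma binary_expansion_unique:
  assumes "x \<in> {0..1}"
  shows "\<exists>!d. binary_expansion x d"
proof (cases "x = 1")
  case True
  then show ?thesis by (simp add: binary_expansion_one)
next
  case False
  then have x: "0 \<le> x" "x < 1" using assms by auto
  show ?thesis
  proof (rule ex1I)
    show "binary_expansion x (\<lambda>i. nat (\<lfloor>2 ^ Suc i * x\<rfloor> mod 2))"
      by (rule binary_expansion_floor_digits[OF x])
  next
    fix d assume "binary_expansion x d"
    from binary_expansion_floor[OF this x(2)]
    show "d = (\<lambda>i. nat (\<lfloor>2 ^ Suc i * x\<rfloor> mod 2))" by (intro ext) (metis nat_int)
  qed
qed

lemma binary_expansion_binary_digits:
  "x \<in> {0..1} \<Longrightarrow> binary_expansion x (binary_digits x)"
  unfolding binary_digits_def by (rule theI'[OF binary_expansion_unique])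

lemma binary_digits_eq:
  assumes "x \<in> {0..1}"
  shows "binary_digits x i = (if x = 1 then 1 else nat (\<lfloor>2 ^ Suc i * x\<rfloor> mod 2))"
proof (cases "x = 1")
  case True
  then show ?thesis using binary_expansion_binary_digits[OF assms] by (simp add: binary_expansion_one)
next
  case False
  then show ?thesis using binary_expansion_floor[OF binary_expansion_binary_digits[OF assms], of i] assms
    by (metis atLeastAtMost_iff nat_int order_le_less)
qed

end

theory Submission
  imports Defs
begin

text \<open>
  In the coordinates $u = 2x - 1 \in [-1, 1]$ the functional $8xyz$ equals $uvw$ plus terms
  in pairs of variables, whose integrals are the same for every admissible measure. For the
  triple product there are explicit potentials $f_n$, self-similar under the tent map, such that
  the gap $G_n(u,v,w) = uvw - f_n(u,v) - f_n(u,w) - f_n(v,w)$ is at least $-8^{-n}$ on the whole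
  cube and at most $8^{-n}$ on the graph of the bitwise addition. Integrating the gap, the
  bitwise addition is optimal up to $2 \cdot 8^{-n}$ for every $n$. The potentials are even in
  each variable, so replacing $w$ by $-w$, i.e. $z$ by $1 - z$, settles the maximum as well.

  That $y \mapsto x \oplus y$ preserves Lebesgue measure follows by comparing the distribution
  functions of $d \oplus y$ and $e \oplus y$ for two digit sequences $d$, $e$: splitting off the
  first digit of $y$ halves their distance, so they coincide, and $0 \oplus y = y$.
\<close>

section \<open>Potentials for the triple product\<close>

text \<open>On a signed binary expansion, with terms \<open>a i / 2 ^ Suc i\<close> and
  \<open>a i = 1\<close> or \<open>a i = - 1\<close>, this map drops the leading sign and multiplies
  the shifted rest by it.\<close>

definition tent :: "real \<Rightarrow> real" where
  "tent u = 2 * \<bar>u\<bar> - 1"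

text \<open>With \<open>p = tent u\<close> one has \<open>\<bar>u\<bar> = (1 + p) / 2\<close>. Hence
  \<open>8 * \<bar>u * v * w\<bar>\<close> is the product of \<open>1 + p\<close>,
  \<open>1 + q\<close>, \<open>1 + r\<close>. All its terms except \<open>p * q * r\<close> are
  shared equally among the three pairs, which explains the \<open>1 / 2\<close> and the
  \<open>1 / 3\<close>.\<close>

fun potential :: "nat \<Rightarrow> real \<Rightarrow> real \<Rightarrow> real" where
  "potential 0 u v = 0"
| "potential (Suc n) u v =
     (potential n (tent u) (tent v) - tent u * tent v - (tent u + tent v) / 2 - 1 / 3) / 8"

definition gap :: "nat \<Rightarrow> real \<Rightarrow> real \<Rightarrow> real \<Rightarrow> real" where
  "gap n u v w = u * v * w - potential n u v - potential n u w - potential n v w"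

text \<open>This is \<open>(1 + u) * (1 + v) * (1 + w) - u * v * w\<close>.\<close>

definition slack :: "real \<Rightarrow> real \<Rightarrow> real \<Rightarrow> real" where
  "slack u v w = u * v + u * w + v * w + u + v + w + 1"

lemma tent_minus [simp]: "tent (- u) = tent u"
  by (simp add: tent_def)

lemma tent_bounds: "\<bar>u\<bar> \<le> 1 \<Longrightarrow> \<bar>tent u\<bar> \<le> 1"
  by (simp add: tent_def abs_le_iff)

lemma potential_minus [simp]:
  "potential n (- u) v = potential n u v" "potential n u (- v) = potential n u v"
  by (cases n; simp)+

lemma potential_bound: "\<bar>u\<bar> \<le> 1 \<Longrightarrow> \<bar>v\<bar> \<le> 1 \<Longrightarrow> \<bar>potential n u v\<bar> \<le> 1"
proof (induction n arbitrary: u v)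
  case (Suc n)
  let ?p = "tent u" and ?q = "tent v"
  have b: "\<bar>?p\<bar> \<le> 1" "\<bar>?q\<bar> \<le> 1" using Suc.prems by (simp_all add: tent_bounds)
  then have "\<bar>?p * ?q\<bar> \<le> 1" by (simp add: abs_mult mult_le_one)
  with Suc.IH[OF b] b
  have "\<bar>potential n ?p ?q - ?p * ?q - (?p + ?q) / 2 - 1 / 3\<bar> \<le> 8"
    by (simp add: abs_le_iff add_divide_distrib)
  then show ?case by simp
qed simp

lemma potential_measurable [measurable]:
  assumes [measurable]: "f \<in> borel_measurable M" "g \<in> borel_measurable M"
  shows "(\<lambda>x. potential n (f x) (g x)) \<in> borel_measurable M"
  using assms
proof (induction n arbitrary: f g)
  case (Suc n)
  note [measurable] = Suc.prems
  have [measurable]: "(\<lambda>x. tent (f x)) \<in> borel_measurable M" "(\<lambda>x. tent (g x)) \<in> borel_measurable M"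
    unfolding tent_def by measurable
  have [measurable]: "(\<lambda>x. potential n (tent (f x)) (tent (g x))) \<in> borel_measurable M"
    by (rule Suc.IH) measurable
  show ?case by simp
qed simp

section \<open>Symmetries and recursions of the gap\<close>

lemma gap_minus:
  "gap n (- u) (- v) w = gap n u v w" "gap n (- u) v (- w) = gap n u v w"
  "gap n u (- v) (- w) = gap n u v w"
  by (simp_all add: gap_def)

text \<open>Here \<open>8 * (u * v * w)\<close> is minus the product of the factors
  \<open>1 + tent\<close>, so its lower-order terms cancel exactly against those built into
  \<open>potential (Suc n)\<close>.\<close>

lemma gap_Suc_nonpos:
  assumes "u * v * w \<le> 0"
  shows "8 * gap (Suc n) u v w = gap n (- tent u) (- tent v) (- tent w)"
proof -
  have "u * v * w = - (\<bar>u\<bar> * \<bar>v\<bar> * \<bar>w\<bar>)" using assms by (simp flip: abs_mult)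
  then show ?thesis by (simp add: gap_def) (simp add: tent_def field_simps)
qed

text \<open>With the opposite sign of the product the lower-order terms add up instead of
  cancelling, whence twice \<open>slack\<close>.\<close>

lemma gap_Suc_nonneg:
  assumes "0 \<le> u * v * w"
  shows "8 * gap (Suc n) u v w =
    gap n (tent u) (tent v) (tent w) + 2 * slack (tent u) (tent v) (tent w)"
proof -
  have "u * v * w = \<bar>u\<bar> * \<bar>v\<bar> * \<bar>w\<bar>" using assms by (simp flip: abs_mult)
  then show ?thesis by (simp add: gap_def slack_def) (simp add: tent_def field_simps)
qed

lemma slack_commute: "slack u v w = slack v u w" "slack u v w = slack u w v"
  by (simp_all add: slack_def)

lemma potential_commute: "potential n u v = potential n v u"
  by (induction n arbitrary: u v) (simp_all add: algebra_simps)

lemma gap_commute: "gap n u v w = gap n v u w" "gap n u v w = gap n u w v"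
  by (simp_all add: gap_def potential_commute[of n u] potential_commute[of n w v])

section \<open>Lower bound for the gap on the cube\<close>

lemma pair_sum_ge:
  fixes p q r :: real
  assumes "\<bar>p\<bar> \<le> 1" "\<bar>q\<bar> \<le> 1" "\<bar>r\<bar> \<le> 1"
  shows "- 1 \<le> p * q + p * r + q * r"
proof -
  \<comment> \<open>The odd terms cancel in the sum of these two products, leaving twice
    \<open>1 + p * q + p * r + q * r\<close>.\<close>
  have "0 \<le> (1 + p) * (1 + q) * (1 + r)" "0 \<le> (1 - p) * (1 - q) * (1 - r)"
    using assms by (simp_all add: abs_le_iff)
  then show ?thesis by (simp add: algebra_simps)
qed

lemma slack_ge:
  assumes "\<bar>u\<bar> \<le> 1" "\<bar>v\<bar> \<le> 1" "\<bar>w\<bar> \<le> 1"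
  shows "- (u * v * w) \<le> slack u v w"
proof -
  have "0 \<le> (1 + u) * (1 + v) * (1 + w)" using assms by (simp add: abs_le_iff)
  then show ?thesis by (simp add: slack_def algebra_simps)
qed

text \<open>The lower bound for the gap alone does not propagate; it does together with the one for
  the corrected gap.\<close>

lemma gap_slack_Suc:
  assumes IH: "\<And>u v w. \<bar>u\<bar> \<le> 1 \<Longrightarrow> \<bar>v\<bar> \<le> 1 \<Longrightarrow> \<bar>w\<bar> \<le> 1 \<Longrightarrow> - e \<le> gap n u v w"
    and IHs: "\<And>u v w. \<bar>u\<bar> \<le> 1 \<Longrightarrow> \<bar>v\<bar> \<le> 1 \<Longrightarrow> \<bar>w\<bar> \<le> 1 \<Longrightarrow> - e \<le> gap n u v w + 2 * slack u v w"
    and b: "\<bar>u\<bar> \<le> 1" "\<bar>v\<bar> \<le> 1" "\<bar>w\<bar> \<le> 1"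
  shows "- e \<le> 8 * (gap (Suc n) u v w + 2 * slack u v w)"
proof -
  \<comment> \<open>Gap and slack are symmetric, so ordered triples suffice; the cases below then
    only count how many coordinates are nonpositive.\<close>
  have ord: "- e \<le> 8 * (gap (Suc n) u v w + 2 * slack u v w)" if "u \<le> v" "v \<le> w" "\<bar>u\<bar> \<le> 1" "\<bar>v\<bar> \<le> 1" "\<bar>w\<bar> \<le> 1" for u v w :: real
  proof -
    let ?p = "tent u" and ?q = "tent v" and ?r = "tent w"
    have p: "\<bar>?p\<bar> \<le> 1" "\<bar>?q\<bar> \<le> 1" "\<bar>?r\<bar> \<le> 1" using that by (simp_all add: tent_bounds)
    consider "w \<le> 0" | "v \<le> 0" "0 \<le> w" | "u \<le> 0" "0 \<le> v" | "0 \<le> u" using that by linarith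
    then show ?thesis
    proof cases
      case 1
      have "0 \<le> u * v" using 1 that by (simp add: mult_nonpos_nonpos)
      then have "u * v * w \<le> 0" using 1 by (rule mult_nonneg_nonpos)
      then have "- e \<le> 8 * gap (Suc n) u v w" using IH p by (simp add: gap_Suc_nonpos)
      moreover have "16 * slack u v w = 4 * (1 + (?p * ?q + ?p * ?r + ?q * ?r))"
        using 1 that by (simp add: slack_def tent_def algebra_simps)
      ultimately show ?thesis using pair_sum_ge[OF p] by simp
    next
      case 2
      have "0 \<le> u * v" using 2 that by (simp add: mult_nonpos_nonpos)
      then have "8 * gap (Suc n) u v w = gap n (- ?p) (- ?q) ?r + 2 * slack ?p ?q ?r"
        using 2 by (simp add: gap_Suc_nonneg gap_minus)
      \<comment> \<open>Flipping \<open>?p\<close> and \<open>?q\<close> preserves the gap but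
        changes the slack. The difference is absorbed by \<open>16 * slack u v w\<close>, up to a
        product of nonnegative factors.\<close>
      moreover have "2 * slack ?p ?q ?r + 16 * slack u v w =
          2 * slack (- ?p) (- ?q) ?r + 4 * ((1 - ?p) * (1 - ?q))"
        using 2 that by (simp add: slack_def tent_def algebra_simps)
      moreover have "- e \<le> gap n (- ?p) (- ?q) ?r + 2 * slack (- ?p) (- ?q) ?r"
        using IHs[of "- ?p" "- ?q" ?r] p by simp
      moreover have "0 \<le> (1 - ?p) * (1 - ?q)" using p by (simp add: abs_le_iff)
      ultimately show ?thesis unfolding distrib_left by linarith
    next
      case 3
      have "u * v \<le> 0" using 3 by (simp add: mult_nonpos_nonneg)
      then have neg: "u * v * w \<le> 0" using 3 that by (simp add: mult_nonpos_nonneg)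
      then have "- e \<le> 8 * gap (Suc n) u v w" using IH p by (simp add: gap_Suc_nonpos)
      moreover have "0 \<le> slack u v w" using slack_ge[OF that(3-5)] neg by simp
      ultimately show ?thesis by simp
    next
      case 4
      then have "- e \<le> 8 * gap (Suc n) u v w" using IHs p that by (simp add: gap_Suc_nonneg)
      moreover have "0 \<le> slack u v w" using 4 that by (simp add: slack_def)
      ultimately show ?thesis by simp
    qed
  qed
  consider "u \<le> v" "v \<le> w" | "u \<le> w" "w \<le> v" | "v \<le> u" "u \<le> w" | "v \<le> w" "w \<le> u"
    | "w \<le> u" "u \<le> v" | "w \<le> v" "v \<le> u" by linarith
  then show ?thesis
    by cases (use ord b in \<open>metis gap_commute slack_commute\<close>)+
qed

text \<open>The two bounds feed each other: where \<open>0 \<le> u * v * w\<close>, the plain bound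
  at \<open>Suc n\<close> is the corrected bound at \<open>n\<close>. Every step gains the factor
  \<open>1 / 8\<close>.\<close>

lemma gap_lower:
  assumes "\<bar>u\<bar> \<le> 1" "\<bar>v\<bar> \<le> 1" "\<bar>w\<bar> \<le> 1"
  shows "- ((1 / 8) ^ n) \<le> gap n u v w \<and> - ((1 / 8) ^ n) \<le> gap n u v w + 2 * slack u v w"
  using assms
proof (induction n arbitrary: u v w)
  case 0
  have "\<bar>u * v * w\<bar> \<le> 1" using 0 by (simp add: abs_mult mult_le_one)
  \<comment> \<open>As \<open>slack\<close> is at least \<open>- (u * v * w)\<close>, the corrected
    gap is at least \<open>- (u * v * w)\<close> too.\<close>
  then show ?case using slack_ge[OF 0] by (auto simp: gap_def abs_le_iff)
next
  case (Suc n)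
  have p: "\<bar>tent u\<bar> \<le> 1" "\<bar>tent v\<bar> \<le> 1" "\<bar>tent w\<bar> \<le> 1"
    using Suc.prems by (simp_all add: tent_bounds)
  have "- ((1 / 8) ^ n) \<le> 8 * gap (Suc n) u v w"
    using Suc.IH[of "tent u" "tent v" "tent w"] Suc.IH[of "- tent u" "- tent v" "- tent w"] p
      gap_Suc_nonpos[of u v w n] gap_Suc_nonneg[of u v w n] by (cases "u * v * w \<le> 0") simp_all
  moreover have "- ((1 / 8) ^ n) \<le> 8 * (gap (Suc n) u v w + 2 * slack u v w)"
    by (rule gap_slack_Suc) (use Suc in auto)
  ultimately show ?case by simp
qed

section \<open>Binary series\<close>

lemma half_powers_sums: "(\<lambda>i. 1 / 2 ^ Suc i :: real) sums 1"
  using power_half_series by (simp add: power_one_over)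

text \<open>Taken with signs \<open>- 1\<close>, \<open>1\<close> for points of [-1, 1] and with
  digits \<open>0\<close>, \<open>1\<close> for points of [0, 1].\<close>

definition dyadic_series :: "(nat \<Rightarrow> real) \<Rightarrow> real" where
  "dyadic_series a = (\<Sum>i. a i / 2 ^ Suc i)"

lemma dyadic_series_bounds:
  fixes a :: "nat \<Rightarrow> real"
  assumes a: "\<And>i. \<bar>a i\<bar> \<le> 1"
  shows "summable (\<lambda>i. a i / 2 ^ Suc i)" "\<bar>dyadic_series a\<bar> \<le> 1"
proof -
  have le: "norm (a i / 2 ^ Suc i) \<le> 1 / 2 ^ Suc i" for i
    using a[of i] by (simp add: divide_right_mono del: power_Suc)
  have s: "summable (\<lambda>i. norm (a i / 2 ^ Suc i))"
    by (rule summable_comparison_test'[OF sums_summable[OF half_powers_sums], of 0]) (use le in simp)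
  then show "summable (\<lambda>i. a i / 2 ^ Suc i)" by (rule summable_norm_cancel)
  have "norm (dyadic_series a) \<le> (\<Sum>i. norm (a i / 2 ^ Suc i))"
    unfolding dyadic_series_def by (rule summable_norm[OF s])
  also have "\<dots> \<le> 1" using suminf_le[OF le s sums_summable[OF half_powers_sums]] half_powers_sums by (simp add: sums_iff)
  finally show "\<bar>dyadic_series a\<bar> \<le> 1" by simp
qed

lemma dyadic_series_Suc:
  assumes "\<And>i. \<bar>a i\<bar> \<le> 1"
  shows "2 * dyadic_series a = a 0 + dyadic_series (\<lambda>i. a (Suc i))"
proof -
  have "(\<lambda>i. 2 * (a (Suc i) / 2 ^ Suc (Suc i))) sums (2 * (dyadic_series a - a 0 / 2 ^ Suc 0))"
    using dyadic_series_bounds(1)[OF assms] unfolding dyadic_series_def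
    by (intro sums_mult) (rule sums_Suc_iff[THEN iffD2], simp add: summable_sums)
  then show ?thesis by (simp add: dyadic_series_def sums_iff)
qed

text \<open>Splitting by arbitrary sign sequences, rather than by the canonical expansion of each number,
  avoids an exceptional set where the digits of the sum are not the sums of the digits.\<close>

lemma gap_upper:
  assumes "\<And>i. \<bar>a i\<bar> = 1" "\<And>i. \<bar>b i\<bar> = 1"
  shows "gap n (dyadic_series a) (dyadic_series b) (dyadic_series (\<lambda>i. - (a i * b i))) \<le> (1 / 8) ^ n"
  using assms
proof (induction n arbitrary: a b)
  case 0
  let ?c = "\<lambda>i. - (a i * b i)"
  have "\<bar>dyadic_series a\<bar> \<le> 1" "\<bar>dyadic_series b\<bar> \<le> 1" "\<bar>dyadic_series ?c\<bar> \<le> 1"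
    by (rule dyadic_series_bounds, simp add: 0 abs_mult)+
  then have "\<bar>dyadic_series a * dyadic_series b * dyadic_series ?c\<bar> \<le> 1"
    by (simp add: abs_mult mult_le_one)
  then show ?case by (simp add: gap_def)
next
  case (Suc n)
  let ?c = "\<lambda>i. - (a i * b i)"
  let ?S = "\<lambda>a. dyadic_series (\<lambda>i. a (Suc i))"
  \<comment> \<open>The tail is at most 1 in absolute value, so the leading sign \<open>x 0\<close>
    decides the sign of the whole series.\<close>
  have "\<bar>x 0\<bar> = 1 \<Longrightarrow> tent (dyadic_series x) = x 0 * ?S x \<and> \<bar>dyadic_series x\<bar> = x 0 * dyadic_series x"
    if "\<And>i. \<bar>x i\<bar> = 1" for x :: "nat \<Rightarrow> real"
  proof -
    have "\<bar>?S x\<bar> \<le> 1" by (rule dyadic_series_bounds) (simp add: that)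
    moreover have "x 0 = 1 \<or> x 0 = - 1" using that[of 0] by linarith
    moreover have "2 * dyadic_series x = x 0 + ?S x" by (rule dyadic_series_Suc) (simp add: that)
    ultimately show ?thesis by (auto simp: tent_def)
  qed
  then have t: "tent (dyadic_series x) = x 0 * ?S x" "\<bar>dyadic_series x\<bar> = x 0 * dyadic_series x"
    if "\<And>i. \<bar>x i\<bar> = 1" for x :: "nat \<Rightarrow> real" using that by blast+
  have c: "\<bar>?c i\<bar> = 1" for i using Suc.prems by (simp add: abs_mult)
  have ab: "a 0 = 1 \<or> a 0 = - 1" "b 0 = 1 \<or> b 0 = - 1"
    using Suc.prems(1)[of 0] Suc.prems(2)[of 0] by linarith+
  have "\<bar>dyadic_series a * dyadic_series b * dyadic_series ?c\<bar> =
      - ((a 0)\<^sup>2 * (b 0)\<^sup>2) * (dyadic_series a * dyadic_series b * dyadic_series ?c)"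
    using t(2)[OF Suc.prems(1)] t(2)[OF Suc.prems(2)] t(2)[OF c]
    by (simp add: abs_mult power2_eq_square)
  \<comment> \<open>The leading signs \<open>a 0\<close>, \<open>b 0\<close>,
    \<open>- (a 0 * b 0)\<close> multiply to \<open>- 1\<close>, so the recursion without slack
    applies.\<close>
  then have "dyadic_series a * dyadic_series b * dyadic_series ?c \<le> 0" using ab by auto
  then have "8 * gap (Suc n) (dyadic_series a) (dyadic_series b) (dyadic_series ?c) =
      gap n (- (a 0 * ?S a)) (- (b 0 * ?S b)) (- (?c 0 * ?S ?c))"
    using t(1)[OF Suc.prems(1)] t(1)[OF Suc.prems(2)] t(1)[OF c] by (simp add: gap_Suc_nonpos)
  \<comment> \<open>The three multipliers \<open>- a 0\<close>, \<open>- b 0\<close>,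
    \<open>a 0 * b 0\<close> have product 1: either none or two of them are negative, and
    \<open>gap_minus\<close> removes them.\<close>
  also have "\<dots> = gap n (?S a) (?S b) (?S ?c)" using ab by (auto simp: gap_minus)
  also have "\<dots> \<le> (1 / 8) ^ n" by (rule Suc.IH) (simp_all add: Suc.prems)
  finally show ?case by simp
qed

section \<open>Adding a fixed digit sequence to a number\<close>

text \<open>Agrees with \<open>binary_digits\<close> on $[0, 1)$ but not at 1.\<close>

definition floor_digit :: "real \<Rightarrow> nat \<Rightarrow> nat" where
  "floor_digit y i = nat (\<lfloor>2 ^ Suc i * y\<rfloor> mod 2)"

text \<open>One summand is a digit sequence rather than a number, so that it can be shifted in an
  induction without asking whether the shifted sequence is a canonical expansion.\<close>

definition xor_series :: "(nat \<Rightarrow> nat) \<Rightarrow> real \<Rightarrow> real" where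
  "xor_series d y = dyadic_series (\<lambda>i. real ((d i + floor_digit y i) mod 2))"

lemma mod_two_le_one: "\<bar>real (n mod 2)\<bar> \<le> 1"
  using mod_less_divisor[of 2 n] by simp

lemma dyadic_series_mod_two:
  "0 \<le> dyadic_series (\<lambda>i. real (a i mod 2))" "dyadic_series (\<lambda>i. real (a i mod 2)) \<le> 1"
proof -
  have "\<bar>dyadic_series (\<lambda>i. real (a i mod 2))\<bar> \<le> 1"
    by (rule dyadic_series_bounds) (rule mod_two_le_one)
  then show "dyadic_series (\<lambda>i. real (a i mod 2)) \<le> 1" by simp
  have "summable (\<lambda>i. real (a i mod 2) / 2 ^ Suc i)"
    by (rule dyadic_series_bounds) (rule mod_two_le_one)
  then show "0 \<le> dyadic_series (\<lambda>i. real (a i mod 2))"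
    unfolding dyadic_series_def by (rule suminf_nonneg) simp
qed

lemma xor_series_bounds: "0 \<le> xor_series d y" "xor_series d y \<le> 1"
  unfolding xor_series_def by (rule dyadic_series_mod_two)+

lemma floor_digit_measurable [measurable]: "(\<lambda>y. floor_digit y i) \<in> borel \<rightarrow>\<^sub>M count_space UNIV"
  unfolding floor_digit_def by measurable

lemma xor_series_measurable [measurable]: "xor_series d \<in> borel_measurable borel"
  unfolding xor_series_def[abs_def] dyadic_series_def by measurable

text \<open>The map \<open>y \<mapsto> (b + y) / 2\<close> prepends the digit \<open>b\<close>. At
  later positions it only adds an even integer under the floor.\<close>

lemma floor_digit_half:
  assumes "0 \<le> y" "y < 1" "b < 2"
  shows "floor_digit ((real b + y) / 2) 0 = b"
    and "floor_digit ((real b + y) / 2) (Suc i) = floor_digit y i"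
proof -
  have "\<lfloor>real b + y\<rfloor> = int b" using assms by linarith
  then show "floor_digit ((real b + y) / 2) 0 = b" using assms(3) by (simp add: floor_digit_def del: distrib_left_numeral)
  have "2 ^ Suc (Suc i) * ((real b + y) / 2) = 2 ^ Suc i * y + of_int (2 * (2 ^ i * int b))"
    by (simp add: field_simps)
  then have "\<lfloor>2 ^ Suc (Suc i) * ((real b + y) / 2)\<rfloor> = \<lfloor>2 ^ Suc i * y\<rfloor> + 2 * (2 ^ i * int b)"
    by (metis floor_add_int)
  then show "floor_digit ((real b + y) / 2) (Suc i) = floor_digit y i"
    by (simp only: floor_digit_def mod_mult_self2)
qed

lemma xor_series_half:
  assumes "0 \<le> y" "y < 1" "b < 2"
  shows "xor_series d ((real b + y) / 2) =
    (real ((d 0 + b) mod 2) + xor_series (\<lambda>i. d (Suc i)) y) / 2"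
proof -
  have "2 * xor_series d ((real b + y) / 2) =
    real ((d 0 + b) mod 2) + xor_series (\<lambda>i. d (Suc i)) y"
    unfolding xor_series_def by (subst dyadic_series_Suc)
      (simp_all only: floor_digit_half[OF assms] mod_two_le_one)
  then show ?thesis by simp
qed

lemma floor_digit_sums:
  assumes "0 \<le> y" "y < 1"
  shows "(\<lambda>i. real (floor_digit y i) / 2 ^ Suc i) sums y"
  using binary_expansion_floor_digits[OF assms]
  unfolding binary_expansion_def floor_digit_def by blast

lemma xor_series_zero:
  assumes "0 \<le> y" "y < 1"
  shows "xor_series (\<lambda>_. 0) y = y"
proof -
  have "floor_digit y i mod 2 = floor_digit y i" for i
    by (simp add: floor_digit_def nat_mod_distrib)
  then show ?thesis using floor_digit_sums[OF assms] by (simp add: xor_series_def dyadic_series_def sums_iff)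
qed

text \<open>Adding the all-ones sequence complements every digit. This makes the reflection
  \<open>1 - y\<close> an instance of \<open>xor_series\<close>, so that its invariance comes with
  that of bitwise addition.\<close>

lemma xor_series_one:
  assumes "0 \<le> y" "y < 1"
  shows "xor_series (\<lambda>_. 1) y = 1 - y"
proof -
  have "(\<lambda>i. 1 / 2 ^ Suc i - real (floor_digit y i) / 2 ^ Suc i) sums (1 - y)"
    by (intro sums_diff half_powers_sums floor_digit_sums assms)
  moreover have "real ((1 + floor_digit y i) mod 2) = 1 - real (floor_digit y i)" for i
  proof -
    have "floor_digit y i = 0 \<or> floor_digit y i = 1"
      unfolding floor_digit_def by (auto simp: nat_eq_iff)
    then show ?thesis by auto
  qed
  ultimately show ?thesis
    by (simp add: xor_series_def dyadic_series_def sums_iff diff_divide_distrib del: power_Suc)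
qed

section \<open>Bitwise addition preserves Lebesgue measure\<close>

lemma measure_lborel_affine:
  fixes A :: "real set"
  assumes [measurable]: "A \<in> sets borel" and "c \<noteq> 0"
  shows "measure lborel A = \<bar>c\<bar> * measure lborel {y. t + c * y \<in> A}"
proof -
  have "measure lborel A = (\<integral>y. indicator A y \<partial>lborel)" by simp
  also have "\<dots> = \<bar>c\<bar> *\<^sub>R (\<integral>y. indicator A (t + c * y) \<partial>lborel)"
    by (rule lborel_integral_real_affine[OF assms(2)])
  also have "(\<lambda>y. indicator A (t + c * y) :: real) = indicator {y. t + c * y \<in> A}"
    by (auto simp: indicator_def)
  finally show ?thesis by simp
qed

text \<open>Splits by the first binary digit: each half of the interval is the whole one scaled by
  \<open>1 / 2\<close>.\<close>

lemma measure_unit_halves: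
  fixes A :: "real set"
  assumes A [measurable]: "A \<in> sets borel"
  shows "measure lborel {y \<in> {0..<1}. y \<in> A} =
    (measure lborel {y \<in> {0..<1}. y / 2 \<in> A} + measure lborel {y \<in> {0..<1}. (1 + y) / 2 \<in> A}) / 2"
proof -
  let ?L = "{0..<1/2} \<inter> A" and ?R = "{1/2..<1} \<inter> A"
  have fin: "emeasure lborel (I \<inter> A) \<noteq> \<infinity>" if "I \<subseteq> {0..1}" for I
  proof -
    have "emeasure lborel (I \<inter> A) \<le> emeasure lborel {0..1::real}"
      by (rule emeasure_mono) (use that in auto)
    then show ?thesis by (auto simp: top_unique)
  qed
  have "{y \<in> {0..<1}. y \<in> A} = ?L \<union> ?R" by auto
  then have "measure lborel {y \<in> {0..<1}. y \<in> A} = measure lborel ?L + measure lborel ?R"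
    using measure_Union[of lborel ?L ?R] fin[of "{0..<1/2}"] fin[of "{1/2..<1}"]
    by (simp add: disjoint_iff subset_eq)
  moreover have "{y. 0 + 1/2 * y \<in> ?L} = {y \<in> {0..<1}. y / 2 \<in> A}"
    "{y. 1/2 + 1/2 * y \<in> ?R} = {y \<in> {0..<1}. (1 + y) / 2 \<in> A}"
    by (auto simp: field_simps)
  moreover have "measure lborel ?L = 1/2 * measure lborel {y. 0 + 1/2 * y \<in> ?L}"
    "measure lborel ?R = 1/2 * measure lborel {y. 1/2 + 1/2 * y \<in> ?R}"
    using measure_lborel_affine[of ?L "1/2" 0] measure_lborel_affine[of ?R "1/2" "1/2"] by simp_all
  ultimately show ?thesis by (simp only:) simp
qed

text \<open>The half-open interval leaves out the point 1, where \<open>floor_digit_half\<close>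
  fails.\<close>

definition xor_cdf :: "(nat \<Rightarrow> nat) \<Rightarrow> real \<Rightarrow> real" where
  "xor_cdf d t = measure lborel {y \<in> {0..<1}. xor_series d y \<le> t}"

text \<open>The first digit of \<open>y\<close> is 0 on one half of the interval and 1 on the other,
  so the first digit of the sum also takes each value on one half. The digit \<open>d 0\<close> only
  decides which, and thus drops out.\<close>

lemma xor_cdf_half:
  "xor_cdf d t = (xor_cdf (\<lambda>i. d (Suc i)) (2 * t) + xor_cdf (\<lambda>i. d (Suc i)) (2 * t - 1)) / 2"
proof -
  let ?s = "\<lambda>i. d (Suc i)"
  have [measurable]: "{y. xor_series d y \<le> t} \<in> sets borel" by measurable
  have "{y \<in> {0..<1}. xor_series d ((real b + y) / 2) \<le> t} =
      {y \<in> {0..<1}. xor_series ?s y \<le> 2 * t - real ((d 0 + b) mod 2)}" if "b < 2" for b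
    by (auto simp: xor_series_half that)
  from this[of 0] this[of 1]
  have "{y \<in> {0..<1}. xor_series d (y / 2) \<le> t} =
      {y \<in> {0..<1}. xor_series ?s y \<le> 2 * t - real (d 0 mod 2)}"
    "{y \<in> {0..<1}. xor_series d ((1 + y) / 2) \<le> t} =
      {y \<in> {0..<1}. xor_series ?s y \<le> 2 * t - real ((d 0 + 1) mod 2)}" by simp_all
  then have "xor_cdf d t =
      (xor_cdf ?s (2 * t - real (d 0 mod 2)) + xor_cdf ?s (2 * t - real ((d 0 + 1) mod 2))) / 2"
    using measure_unit_halves[of "{y. xor_series d y \<le> t}"] unfolding xor_cdf_def by simp
  then show ?thesis by (cases "even (d 0)") (simp_all add: odd_iff_mod_2_eq_one even_iff_mod_2_eq_zero mod_Suc)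
qed

lemma xor_cdf_neg: "t < 0 \<Longrightarrow> xor_cdf d t = 0"
proof -
  assume "t < 0"
  then have "{y \<in> {0..<1}. xor_series d y \<le> t} = {}"
    using xor_series_bounds(1)[of d] by (auto simp: not_le intro: less_le_trans)
  then show ?thesis by (simp only: xor_cdf_def measure_empty)
qed

lemma xor_cdf_ge_one: "1 \<le> t \<Longrightarrow> xor_cdf d t = 1"
proof -
  assume "1 \<le> t"
  then have "{y \<in> {0..<1}. xor_series d y \<le> t} = {0..<1}"
    using xor_series_bounds(2)[of d] by (auto intro: order_trans)
  then show ?thesis by (simp add: xor_cdf_def)
qed

lemma xor_cdf_bounds: "0 \<le> xor_cdf d t" "xor_cdf d t \<le> 1"
proof -
  have [measurable]: "{y \<in> {0..<1}. xor_series d y \<le> t} \<in> sets borel" by measurable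
  have "measure lborel {y \<in> {0..<1}. xor_series d y \<le> t} \<le> measure lborel {0..<1::real}"
    by (rule measure_mono_fmeasurable) (auto simp: fmeasurable_def)
  then show "xor_cdf d t \<le> 1" by (simp add: xor_cdf_def)
qed (simp add: xor_cdf_def)

text \<open>For \<open>2 * t < 1\<close> the second term of \<open>xor_cdf_half\<close> vanishes;
  otherwise the first term equals 1. Either way a single difference, with factor
  \<open>1 / 2\<close>, survives.\<close>

lemma xor_cdf_cong: "xor_cdf d t = xor_cdf e t"
proof -
  have "\<bar>xor_cdf d t - xor_cdf e t\<bar> \<le> (1 / 2) ^ n" for n
  proof (induction n arbitrary: d e t)
    case 0
    show ?case using xor_cdf_bounds[of d t] xor_cdf_bounds[of e t] by simp
  next
    case (Suc n)
    let ?d = "\<lambda>i. d (Suc i)" and ?e = "\<lambda>i. e (Suc i)"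
    show ?case
    proof (cases "2 * t < 1")
      case True
      then have "xor_cdf d t - xor_cdf e t = (xor_cdf ?d (2 * t) - xor_cdf ?e (2 * t)) / 2"
        unfolding xor_cdf_half[of d] xor_cdf_half[of e] by (simp add: xor_cdf_neg)
      then show ?thesis using Suc.IH[of ?d "2 * t" ?e] by (simp only: abs_divide power_Suc) simp
    next
      case False
      then have "xor_cdf d t - xor_cdf e t = (xor_cdf ?d (2 * t - 1) - xor_cdf ?e (2 * t - 1)) / 2"
        unfolding xor_cdf_half[of d] xor_cdf_half[of e] by (simp add: xor_cdf_ge_one add_divide_distrib)
      then show ?thesis using Suc.IH[of ?d "2 * t - 1" ?e] by (simp only: abs_divide power_Suc) simp
    qed
  qed
  then have "\<bar>xor_cdf d t - xor_cdf e t\<bar> \<le> 0"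
    by (intro LIMSEQ_le_const[OF LIMSEQ_power_zero[of "1/2::real"]]) auto
  then show ?thesis by simp
qed

lemma prob_space_unit: "prob_space unit_lebesgue"
  by (rule prob_space_restrict_space) auto

lemma distr_xor_series: "distr unit_lebesgue borel (xor_series d) = distr unit_lebesgue borel (\<lambda>y. y)"
proof -
  interpret prob_space unit_lebesgue by (rule prob_space_unit)
  have m: "xor_series d \<in> borel_measurable unit_lebesgue" for d
    by (intro measurable_restrict_space1) simp
  have rd: "real_distribution (distr unit_lebesgue borel (xor_series d))" for d
    by (intro real_distribution_distr) (rule m)
  have cdf: "cdf (distr unit_lebesgue borel (xor_series d)) t = xor_cdf d t" for d t
  proof -
    have "cdf (distr unit_lebesgue borel (xor_series d)) t =
        measure unit_lebesgue {y \<in> {0..1}. xor_series d y \<le> t}"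
      unfolding cdf_def by (subst measure_distr[OF m]) (auto simp: space_restrict_space intro!: arg_cong[where f="measure unit_lebesgue"])
    also have "\<dots> = measure lborel {y \<in> {0..1}. xor_series d y \<le> t}"
      by (rule measure_restrict_space) auto
    also have "\<dots> = xor_cdf d t"
      unfolding xor_cdf_def
    proof (rule measure_eq_AE)
      show "AE y in lborel. y \<in> {y \<in> {0..1}. xor_series d y \<le> t} \<longleftrightarrow> y \<in> {y \<in> {0..<1}. xor_series d y \<le> t}"
        using AE_lborel_singleton[of 1] by eventually_elim auto
    qed measurable
    finally show ?thesis .
  qed
  have "distr unit_lebesgue borel (xor_series d) = distr unit_lebesgue borel (xor_series (\<lambda>_. 0))"
    by (rule cdf_unique[OF rd rd]) (use xor_cdf_cong in \<open>auto simp: cdf\<close>)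
  also have "\<dots> = distr unit_lebesgue borel (\<lambda>y. y)"
  proof (rule distr_cong_AE)
    show "AE y in unit_lebesgue. xor_series (\<lambda>_. 0) y = y"
      unfolding AE_restrict_space_iff[of "{0..1::real}" lborel, simplified]
      using AE_lborel_singleton[of "1::real"] by eventually_elim (auto intro: xor_series_zero)
  qed (auto simp: m intro!: measurable_restrict_space1)
  finally show ?thesis .
qed

section \<open>Measurability and invariance for bitwise addition of numbers\<close>

lemma bitwise_add_eq_dyadic_series:
  "x \<oplus>\<^sub>2 y = dyadic_series (\<lambda>i. real ((binary_digits x i + binary_digits y i) mod 2))"
  by (simp add: bitwise_add_def dyadic_series_def)

lemma bitwise_add_bounds: "0 \<le> x \<oplus>\<^sub>2 y" "x \<oplus>\<^sub>2 y \<le> 1"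
  unfolding bitwise_add_eq_dyadic_series by (rule dyadic_series_mod_two)+

lemma bitwise_add_commute: "x \<oplus>\<^sub>2 y = y \<oplus>\<^sub>2 x"
  by (simp add: bitwise_add_def add.commute)

lemma bitwise_add_eq_xor_series:
  assumes "0 \<le> y" "y < 1"
  shows "x \<oplus>\<^sub>2 y = xor_series (binary_digits x) y"
  unfolding bitwise_add_eq_dyadic_series xor_series_def
  using assms by (simp add: binary_digits_eq floor_digit_def)

lemma space_unit [simp]: "space unit_lebesgue = {0..1}"
  by (simp add: space_restrict_space)

text \<open>The definite description is replaced by its closed form, including the exceptional value
  at 1.\<close>

lemma binary_digits_measurable [measurable]:
  "(\<lambda>x. binary_digits x i) \<in> unit_lebesgue \<rightarrow>\<^sub>M count_space UNIV"
proof -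
  have "(\<lambda>x. if x = 1 then 1 else floor_digit x i) \<in> unit_lebesgue \<rightarrow>\<^sub>M count_space UNIV"
    by (rule measurable_restrict_space1) measurable
  then show ?thesis
    by (subst measurable_cong[where g = "\<lambda>x. if x = 1 then 1 else floor_digit x i"])
      (auto simp: binary_digits_eq floor_digit_def)
qed

lemma measurable_into_unit:
  assumes "f \<in> borel_measurable M" "\<And>x. x \<in> space M \<Longrightarrow> f x \<in> {0..1}"
  shows "f \<in> M \<rightarrow>\<^sub>M unit_lebesgue"
  by (rule measurable_restrict_space2) (use assms in auto)

lemma unit_borel_measurable:
  assumes "f \<in> M \<rightarrow>\<^sub>M unit_lebesgue"
  shows "f \<in> borel_measurable M"
proof -
  have "(\<lambda>x. x) \<in> borel_measurable unit_lebesgue" by (rule measurable_restrict_space1) simp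
  from measurable_compose[OF assms this] show ?thesis by simp
qed

lemma bitwise_add_measurable [measurable]:
  assumes [measurable]: "f \<in> M \<rightarrow>\<^sub>M unit_lebesgue" "g \<in> M \<rightarrow>\<^sub>M unit_lebesgue"
  shows "(\<lambda>p. f p \<oplus>\<^sub>2 g p) \<in> M \<rightarrow>\<^sub>M unit_lebesgue"
proof (rule measurable_into_unit)
  show "(\<lambda>p. f p \<oplus>\<^sub>2 g p) \<in> borel_measurable M"
    unfolding bitwise_add_def by measurable
qed (simp add: bitwise_add_bounds)

text \<open>The point 1 is null, so agreement with some \<open>xor_series d\<close> on [0, 1)
  determines the image measure. Serves both bitwise addition and reflection.\<close>

lemma distr_unit_eqI:
  assumes f: "f \<in> unit_lebesgue \<rightarrow>\<^sub>M unit_lebesgue"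
    and eq: "\<And>y. 0 \<le> y \<Longrightarrow> y < 1 \<Longrightarrow> f y = xor_series d y"
  shows "distr unit_lebesgue unit_lebesgue f = unit_lebesgue"
proof (rule measure_eqI)
  have fb: "f \<in> borel_measurable unit_lebesgue"
    using f by (rule unit_borel_measurable)
  have "distr unit_lebesgue borel f = distr unit_lebesgue borel (xor_series d)"
  proof (rule distr_cong_AE)
    show "AE y in unit_lebesgue. f y = xor_series d y"
      unfolding AE_restrict_space_iff[of "{0..1::real}" lborel, simplified]
      using AE_lborel_singleton[of "1::real"] by eventually_elim (auto intro: eq)
  qed (auto simp: fb intro!: measurable_restrict_space1)
  then have eq: "distr unit_lebesgue borel f = distr unit_lebesgue borel (\<lambda>y. y)"
    by (simp add: distr_xor_series)
  have idm: "(\<lambda>y. y) \<in> borel_measurable unit_lebesgue" by (rule measurable_restrict_space1) simp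
  fix A assume A: "A \<in> sets (distr unit_lebesgue unit_lebesgue f)"
  then have Ab: "A \<in> sets borel" "A \<subseteq> {0..1}" by (auto simp: sets_restrict_space_iff)
  have "emeasure (distr unit_lebesgue unit_lebesgue f) A = emeasure (distr unit_lebesgue borel f) A"
    using A Ab by (simp add: emeasure_distr f fb)
  also have "\<dots> = emeasure unit_lebesgue A"
    unfolding eq using Ab by (simp add: emeasure_distr[OF idm] Int_absorb2)
  finally show "emeasure (distr unit_lebesgue unit_lebesgue f) A = emeasure unit_lebesgue A" .
qed simp

lemma distr_bitwise_add:
  assumes "x \<in> {0..1}"
  shows "distr unit_lebesgue unit_lebesgue (\<lambda>y. x \<oplus>\<^sub>2 y) = unit_lebesgue"
  by (rule distr_unit_eqI[of _ "binary_digits x"])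
    (use assms in \<open>auto intro!: bitwise_add_measurable bitwise_add_eq_xor_series\<close>)

lemma one_minus_measurable: "(\<lambda>y. 1 - y) \<in> unit_lebesgue \<rightarrow>\<^sub>M unit_lebesgue"
proof (rule measurable_into_unit)
  show "(\<lambda>y. 1 - y) \<in> borel_measurable unit_lebesgue"
    by (rule measurable_restrict_space1) simp
qed simp

lemma distr_one_minus: "distr unit_lebesgue unit_lebesgue (\<lambda>y. 1 - y) = unit_lebesgue"
  by (rule distr_unit_eqI[OF one_minus_measurable xor_series_one[symmetric]])

text \<open>It suffices to test rectangles \<open>A \<times> B\<close>. The section of the preimage
  at \<open>x\<close> is empty for \<open>x\<close> outside \<open>A\<close> and otherwise has
  measure \<open>emeasure N B\<close>, because \<open>T x\<close> preserves
  \<open>N\<close>.\<close>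

lemma distr_skew_product:
  assumes "sigma_finite_measure M" "sigma_finite_measure N"
    and T [measurable]: "(\<lambda>(x, y). T x y) \<in> M \<Otimes>\<^sub>M N \<rightarrow>\<^sub>M N"
    and pres: "\<And>x. x \<in> space M \<Longrightarrow> distr N N (T x) = N"
  shows "distr (M \<Otimes>\<^sub>M N) (M \<Otimes>\<^sub>M N) (\<lambda>(x, y). (x, T x y)) = M \<Otimes>\<^sub>M N"
proof (rule pair_measure_eqI[symmetric])
  interpret N: sigma_finite_measure N by fact
  let ?g = "\<lambda>(x, y). (x, T x y)"
  have g: "?g \<in> M \<Otimes>\<^sub>M N \<rightarrow>\<^sub>M M \<Otimes>\<^sub>M N" by measurable
  fix A B assume A [measurable]: "A \<in> sets M" and B [measurable]: "B \<in> sets N"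
  have "emeasure (distr (M \<Otimes>\<^sub>M N) (M \<Otimes>\<^sub>M N) ?g) (A \<times> B) =
      emeasure (M \<Otimes>\<^sub>M N) (?g -` (A \<times> B) \<inter> space (M \<Otimes>\<^sub>M N))"
    using g by (simp add: emeasure_distr)
  also have "\<dots> = (\<integral>\<^sup>+x. emeasure N (Pair x -` (?g -` (A \<times> B) \<inter> space (M \<Otimes>\<^sub>M N))) \<partial>M)"
    by (rule N.emeasure_pair_measure_alt) (use g in \<open>auto intro: measurable_sets\<close>)
  also have "\<dots> = (\<integral>\<^sup>+x. emeasure N B * indicator A x \<partial>M)"
  proof (rule nn_integral_cong)
    fix x assume x: "x \<in> space M"
    have m: "T x \<in> N \<rightarrow>\<^sub>M N" using measurable_compose[OF measurable_Pair1'[OF x] T] by simp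
    have "Pair x -` (?g -` (A \<times> B) \<inter> space (M \<Otimes>\<^sub>M N)) =
        (if x \<in> A then T x -` B \<inter> space N else {})"
      using x by (auto simp: space_pair_measure)
    moreover have "emeasure N (T x -` B \<inter> space N) = emeasure N B"
      using emeasure_distr[OF m B] pres[OF x] by simp
    ultimately show "emeasure N (Pair x -` (?g -` (A \<times> B) \<inter> space (M \<Otimes>\<^sub>M N))) =
        emeasure N B * indicator A x" by simp
  qed
  also have "\<dots> = emeasure M A * emeasure N B"
    by (subst nn_integral_cmult_indicator) (simp_all add: mult.commute)
  finally show "emeasure M A * emeasure N B =
    emeasure (distr (M \<Otimes>\<^sub>M N) (M \<Otimes>\<^sub>M N) ?g) (A \<times> B)" by simp
qed (use assms in auto)

text \<open>Exchanging the coordinates, which preserves \<open>M \<Otimes>\<^sub>M M\<close>,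
  reduces this to \<open>distr_skew_product\<close>.\<close>

lemma distr_skew_product_swap:
  assumes "sigma_finite_measure M"
    and T [measurable]: "(\<lambda>(x, y). T x y) \<in> M \<Otimes>\<^sub>M M \<rightarrow>\<^sub>M M"
    and pres: "\<And>y. y \<in> space M \<Longrightarrow> distr M M (\<lambda>x. T x y) = M"
  shows "distr (M \<Otimes>\<^sub>M M) (M \<Otimes>\<^sub>M M) (\<lambda>(x, y). (y, T x y)) = M \<Otimes>\<^sub>M M"
proof -
  interpret pair_sigma_finite M M using assms(1) by (simp add: pair_sigma_finite_def)
  have "distr (M \<Otimes>\<^sub>M M) (M \<Otimes>\<^sub>M M) (\<lambda>(x, y). (y, T x y)) =
    distr (distr (M \<Otimes>\<^sub>M M) (M \<Otimes>\<^sub>M M) (\<lambda>(x, y). (y, x))) (M \<Otimes>\<^sub>M M) (\<lambda>(y, x). (y, T x y))"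
    by (subst distr_distr) (auto simp: comp_def case_prod_unfold intro!: distr_cong)
  also have "\<dots> = distr (M \<Otimes>\<^sub>M M) (M \<Otimes>\<^sub>M M) (\<lambda>(y, x). (y, T x y))"
    by (simp flip: distr_pair_swap)
  also have "\<dots> = M \<Otimes>\<^sub>M M"
    by (rule distr_skew_product[where T = "\<lambda>y x. T x y"]) (use assms(1) pres in auto)
  finally show ?thesis .
qed

section \<open>Measures with uniform two-dimensional marginals\<close>

lemma prob_space_square: "prob_space square_lebesgue"
proof -
  interpret unit: prob_space unit_lebesgue by (rule prob_space_unit)
  interpret pair_prob_space unit_lebesgue unit_lebesgue ..
  show ?thesis by unfold_locales
qed

lemma space_square: "space square_lebesgue = {0..1} \<times> {0..1}"
  by (simp add: space_pair_measure)

lemma cube_projections_measurable: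
  assumes "sets P = sets cube_borel"
  shows "(\<lambda>(x, y, z). (x, y)) \<in> P \<rightarrow>\<^sub>M square_lebesgue"
    "(\<lambda>(x, y, z). (x, z)) \<in> P \<rightarrow>\<^sub>M square_lebesgue"
    "(\<lambda>(x, y, z). (y, z)) \<in> P \<rightarrow>\<^sub>M square_lebesgue"
proof -
  have m: "fst \<in> cube_borel \<rightarrow>\<^sub>M unit_lebesgue" "(\<lambda>p. fst (snd p)) \<in> cube_borel \<rightarrow>\<^sub>M unit_lebesgue"
    "(\<lambda>p. snd (snd p)) \<in> cube_borel \<rightarrow>\<^sub>M unit_lebesgue"
    by (rule measurable_into_unit, rule measurable_restrict_space1, simp flip: borel_prod,
      auto simp: space_restrict_space)+
  show "(\<lambda>(x, y, z). (x, y)) \<in> P \<rightarrow>\<^sub>M square_lebesgue"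
    "(\<lambda>(x, y, z). (x, z)) \<in> P \<rightarrow>\<^sub>M square_lebesgue"
    "(\<lambda>(x, y, z). (y, z)) \<in> P \<rightarrow>\<^sub>M square_lebesgue"
    unfolding measurable_cong_sets[OF assms refl]
    using measurable_Pair[OF m(1,2)] measurable_Pair[OF m(1,3)] measurable_Pair[OF m(2,3)]
    by (simp_all add: case_prod_unfold)
qed

lemma graph_measurable:
  assumes K [measurable]: "(\<lambda>(x, y). K x y) \<in> square_lebesgue \<rightarrow>\<^sub>M unit_lebesgue"
  shows "(\<lambda>(x, y). (x, y, K x y)) \<in> square_lebesgue \<rightarrow>\<^sub>M cube_borel"
proof (rule measurable_restrict_space2)
  have [measurable]: "(\<lambda>p. K (fst p) (snd p)) \<in> borel_measurable square_lebesgue"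
    "fst \<in> borel_measurable square_lebesgue" "snd \<in> borel_measurable square_lebesgue"
    using unit_borel_measurable[OF K]
    by (auto simp: case_prod_unfold intro: unit_borel_measurable)
  show "(\<lambda>(x, y). (x, y, K x y)) \<in> borel_measurable square_lebesgue"
    by (simp add: case_prod_unfold flip: borel_prod)
  show "(\<lambda>(x, y). (x, y, K x y)) \<in> space square_lebesgue \<rightarrow> {0..1} \<times> {0..1} \<times> {0..1}"
    using measurable_space[OF K] by (auto simp: space_square)
qed

text \<open>On the graph the three projections become the identity, a skew product over
  \<open>x\<close> and a skew product over \<open>y\<close>.\<close>

lemma graph_in_P_lambda:
  assumes K: "(\<lambda>(x, y). K x y) \<in> square_lebesgue \<rightarrow>\<^sub>M unit_lebesgue"
    and pres1: "\<And>x. x \<in> {0..1} \<Longrightarrow> distr unit_lebesgue unit_lebesgue (K x) = unit_lebesgue"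
    and pres2: "\<And>y. y \<in> {0..1} \<Longrightarrow> distr unit_lebesgue unit_lebesgue (\<lambda>x. K x y) = unit_lebesgue"
  shows "distr square_lebesgue cube_borel (\<lambda>(x, y). (x, y, K x y)) \<in> P_lambda"
proof -
  interpret unit: prob_space unit_lebesgue by (rule prob_space_unit)
  interpret prob_space square_lebesgue by (rule prob_space_square)
  let ?g = "\<lambda>(x, y). (x, y, K x y)"
  note g = graph_measurable[OF K] and proj = cube_projections_measurable[OF refl]
  have "distr (distr square_lebesgue cube_borel ?g) square_lebesgue (\<lambda>(x, y, z). (x, y)) = square_lebesgue"
    unfolding distr_distr[OF proj(1) g] by (simp add: comp_def case_prod_unfold distr_id)
  moreover have "distr (distr square_lebesgue cube_borel ?g) square_lebesgue (\<lambda>(x, y, z). (x, z)) = square_lebesgue"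
    unfolding distr_distr[OF proj(2) g] using distr_skew_product[OF unit.sigma_finite_measure_axioms unit.sigma_finite_measure_axioms K] pres1
    by (simp add: comp_def case_prod_unfold)
  moreover have "distr (distr square_lebesgue cube_borel ?g) square_lebesgue (\<lambda>(x, y, z). (y, z)) = square_lebesgue"
    unfolding distr_distr[OF proj(3) g] using distr_skew_product_swap[OF unit.sigma_finite_measure_axioms K] pres2
    by (simp add: comp_def case_prod_unfold)
  ultimately show ?thesis by (simp add: P_lambda_def prob_space_distr[OF g])
qed

text \<open>Each summand depends on one pair of coordinates, hence integrates against a prescribed
  marginal; the value is the same for every member of \<open>P_lambda\<close>.\<close>

lemma P_lambda_integral_pairs:
  fixes h1 h2 h3 :: "real \<times> real \<Rightarrow> real"
  assumes P: "P \<in> P_lambda"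
    and h: "integrable square_lebesgue h1" "integrable square_lebesgue h2" "integrable square_lebesgue h3"
  shows "integrable P (\<lambda>(x, y, z). h1 (x, y) + h2 (x, z) + h3 (y, z))"
    and "(\<integral>(x, y, z). h1 (x, y) + h2 (x, z) + h3 (y, z) \<partial>P) =
      integral\<^sup>L square_lebesgue h1 + integral\<^sup>L square_lebesgue h2 + integral\<^sup>L square_lebesgue h3"
proof -
  have sets: "sets P = sets cube_borel"
    and d: "distr P square_lebesgue (\<lambda>(x, y, z). (x, y)) = square_lebesgue"
      "distr P square_lebesgue (\<lambda>(x, y, z). (x, z)) = square_lebesgue"
      "distr P square_lebesgue (\<lambda>(x, y, z). (y, z)) = square_lebesgue"
    using P by (auto simp: P_lambda_def)
  note proj = cube_projections_measurable[OF sets]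
  have transfer: "integrable P (\<lambda>p. h (\<pi> p)) \<and> (\<integral>p. h (\<pi> p) \<partial>P) = integral\<^sup>L square_lebesgue h"
    if "\<pi> \<in> P \<rightarrow>\<^sub>M square_lebesgue" "distr P square_lebesgue \<pi> = square_lebesgue"
      "integrable square_lebesgue h" for \<pi> and h :: "real \<times> real \<Rightarrow> real"
    using integrable_distr[OF that(1), of h] integral_distr[OF that(1), of h] that(2,3) by auto
  note t = transfer[OF proj(1) d(1) h(1)] transfer[OF proj(2) d(2) h(2)] transfer[OF proj(3) d(3) h(3)]
  show "integrable P (\<lambda>(x, y, z). h1 (x, y) + h2 (x, z) + h3 (y, z))"
    using t by (simp add: case_prod_unfold)
  show "(\<integral>(x, y, z). h1 (x, y) + h2 (x, z) + h3 (y, z) \<partial>P) =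
      integral\<^sup>L square_lebesgue h1 + integral\<^sup>L square_lebesgue h2 + integral\<^sup>L square_lebesgue h3"
    using t by (simp add: case_prod_unfold)
qed

text \<open>Approximate duality for transport with fixed two-dimensional marginals. The sum of the
  \<open>h\<close> has equal integrals under \<open>P\<close> and \<open>Q\<close>; it bounds
  \<open>k\<close> from below on the whole cube, as \<open>P\<close> is arbitrary, and from above
  only along \<open>Q\<close>, each time up to \<open>e\<close>.\<close>

lemma P_lambda_comparison:
  fixes h1 h2 h3 :: "real \<times> real \<Rightarrow> real" and k :: "real \<times> real \<times> real \<Rightarrow> real"
  assumes P: "P \<in> P_lambda" and Q: "Q \<in> P_lambda"
    and h: "integrable square_lebesgue h1" "integrable square_lebesgue h2" "integrable square_lebesgue h3"
    and k: "integrable P k" "integrable Q k"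
    and lower: "\<And>x y z. x \<in> {0..1} \<Longrightarrow> y \<in> {0..1} \<Longrightarrow> z \<in> {0..1} \<Longrightarrow>
      h1 (x, y) + h2 (x, z) + h3 (y, z) \<le> k (x, y, z) + e"
    and upper: "AE (x, y, z) in Q. k (x, y, z) \<le> h1 (x, y) + h2 (x, z) + h3 (y, z) + e"
  shows "integral\<^sup>L Q k \<le> integral\<^sup>L P k + 2 * e"
proof -
  let ?h = "\<lambda>(x, y, z). h1 (x, y) + h2 (x, z) + h3 (y, z)"
  interpret P: prob_space P using P by (simp add: P_lambda_def)
  interpret Q: prob_space Q using Q by (simp add: P_lambda_def)
  have space: "space P = {0..1} \<times> {0..1} \<times> {0..1}"
    using P sets_eq_imp_space_eq[of P cube_borel] by (simp add: P_lambda_def space_restrict_space)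
  note hP = P_lambda_integral_pairs[OF P h] and hQ = P_lambda_integral_pairs[OF Q h]
  have "integral\<^sup>L Q k \<le> (\<integral>p. ?h p + e \<partial>Q)"
    using upper by (intro integral_mono_AE k(2) Bochner_Integration.integrable_add hQ(1)) (auto simp: case_prod_unfold)
  also have "\<dots> = integral\<^sup>L P ?h + e"
    using hQ hP by (simp add: Q.prob_space)
  also have "integral\<^sup>L P ?h \<le> (\<integral>p. k p + e \<partial>P)"
    using lower by (intro integral_mono hP(1) Bochner_Integration.integrable_add k(1)) (auto simp: space)
  also have "\<dots> = integral\<^sup>L P k + e" using k(1) by (simp add: P.prob_space)
  finally show ?thesis by simp
qed

lemma gap_upper_bitwise_add:
  assumes "x \<in> {0..1}" "y \<in> {0..1}"
  shows "gap n (2 * x - 1) (2 * y - 1) (2 * (x \<oplus>\<^sub>2 y) - 1) \<le> (1 / 8) ^ n"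
proof -
  let ?a = "\<lambda>x i. 2 * real (binary_digits x i) - 1"
  have digit: "binary_digits x i = 0 \<or> binary_digits x i = 1"
    and sums: "(\<lambda>i. real (binary_digits x i) / 2 ^ Suc i) sums x" if "x \<in> {0..1}" for x i
    using binary_expansion_binary_digits[OF that] by (auto simp: binary_expansion_def)
  have series: "2 * s - 1 = dyadic_series (\<lambda>i. 2 * d i - 1)"
    if "(\<lambda>i. d i / 2 ^ Suc i) sums s" for d s
    using sums_diff[OF sums_mult[OF that, of 2] half_powers_sums]
    by (simp add: dyadic_series_def sums_iff diff_divide_distrib del: power_Suc)
  have "(\<lambda>i. real ((binary_digits x i + binary_digits y i) mod 2) / 2 ^ Suc i) sums (x \<oplus>\<^sub>2 y)"
    unfolding bitwise_add_def
    by (intro summable_sums dyadic_series_bounds) (rule mod_two_le_one)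
  then have "2 * (x \<oplus>\<^sub>2 y) - 1 =
      dyadic_series (\<lambda>i. 2 * real ((binary_digits x i + binary_digits y i) mod 2) - 1)"
    by (rule series)
  \<comment> \<open>Under the substitution of the sign \<open>2 * d - 1\<close> for a digit
    \<open>d\<close>, addition mod 2 becomes the negated product.\<close>
  also have "(\<lambda>i. 2 * real ((binary_digits x i + binary_digits y i) mod 2) - 1) =
      (\<lambda>i. - (?a x i * ?a y i))"
  proof
    fix i
    show "2 * real ((binary_digits x i + binary_digits y i) mod 2) - 1 = - (?a x i * ?a y i)"
      using digit[OF assms(1), of i] digit[OF assms(2), of i] by auto
  qed
  finally have xor: "2 * (x \<oplus>\<^sub>2 y) - 1 = dyadic_series (\<lambda>i. - (?a x i * ?a y i))" .
  have "\<bar>?a x i\<bar> = 1" "\<bar>?a y i\<bar> = 1" for i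
    using digit[OF assms(1), of i] digit[OF assms(2), of i] by auto
  from gap_upper[OF this] show ?thesis
    by (simp only: xor series[OF sums[OF assms(1)]] series[OF sums[OF assms(2)]])
qed

section \<open>Integrability of the product and optimality of the graphs\<close>

lemma product_measurable:
  "(\<lambda>(x::real, y::real, z::real). x * y * z) \<in> borel_measurable cube_borel"
  by (rule measurable_restrict_space1) (simp add: case_prod_unfold flip: borel_prod)

lemma P_lambda_integrable_product:
  assumes "P \<in> P_lambda"
  shows "integrable P (\<lambda>(x, y, z). x * y * z)"
proof -
  interpret prob_space P using assms by (simp add: P_lambda_def)
  have sets: "sets P = sets cube_borel" using assms by (simp add: P_lambda_def)
  from product_measurable have "(\<lambda>(x, y, z). x * y * z) \<in> borel_measurable P"
    by (simp only: measurable_cong_sets[OF sets refl])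
  moreover have "AE p in P. norm (case p of (x, y, z) \<Rightarrow> x * y * z) \<le> 1"
    using sets_eq_imp_space_eq[OF sets]
    by (intro AE_I2) (auto simp: space_restrict_space abs_mult mult_le_one)
  ultimately show ?thesis by (intro integrable_const_bound)
qed

text \<open>Treats both problems at once: \<open>\<sigma> = 1\<close> with the identity gives the
  minimum, \<open>\<sigma> = - 1\<close> with \<open>1 - t\<close> the maximum. The condition on
  \<open>\<theta>\<close> says that in the coordinate \<open>2 * z - 1\<close> it is multiplication
  by \<open>\<sigma>\<close>.\<close>

lemma xor_graph_optimal:
  fixes \<theta> :: "real \<Rightarrow> real"
  assumes \<sigma>: "\<sigma> = 1 \<or> \<sigma> = - 1" and \<theta>: "\<And>t. \<sigma> * (2 * \<theta> t - 1) = 2 * t - 1"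
    and P: "P \<in> P_lambda"
    and Q: "distr square_lebesgue cube_borel (\<lambda>(x, y). (x, y, \<theta> (x \<oplus>\<^sub>2 y))) \<in> P_lambda" (is "?Q \<in> _")
    and K: "(\<lambda>(x, y). \<theta> (x \<oplus>\<^sub>2 y)) \<in> square_lebesgue \<rightarrow>\<^sub>M unit_lebesgue"
  shows "\<sigma> * (\<integral>(x, y, z). x * y * z \<partial>?Q) \<le> \<sigma> * (\<integral>(x, y, z). x * y * z \<partial>P)"
proof -
  let ?k = "\<lambda>p::real \<times> real \<times> real. 8 * \<sigma> * (case p of (x, y, z) \<Rightarrow> x * y * z)"
  have bound: "integral\<^sup>L ?Q ?k \<le> integral\<^sup>L P ?k + 2 * (1 / 8) ^ n" for n
  proof -
    define f where "f = (\<lambda>x y. potential n (2 * x - 1) (2 * y - 1))"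
    \<comment> \<open>With \<open>u = 2 * x - 1\<close> and likewise \<open>v\<close>,
      \<open>w\<close>, one has \<open>8 * x * y * z = (1 + u) * (1 + v) * (1 + w)\<close>. All
      terms but \<open>u * v * w\<close> are distributed over the pairs: \<open>u\<close>,
      \<open>v\<close> and the constant go into \<open>h1\<close>, the term \<open>w\<close> into
      \<open>h2\<close>.\<close>
    define h1 where "h1 = (\<lambda>(x, y). f x y + \<sigma> * ((2 * x - 1) * (2 * y - 1) + (2 * x - 1) + (2 * y - 1) + 1))"
    define h2 where "h2 = (\<lambda>(x, z). f x z + \<sigma> * ((2 * x - 1) * (2 * z - 1) + (2 * z - 1)))"
    define h3 where "h3 = (\<lambda>(y, z). f y z + \<sigma> * ((2 * y - 1) * (2 * z - 1)))"
    \<comment> \<open>Evenness allows \<open>\<sigma>\<close> to move into the third argument of the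
      gap, where the potentials do not see it.\<close>
    have signed: "potential n u (\<sigma> * v) = potential n u v" for u v using \<sigma> by auto
    have split: "?k (x, y, z) - (h1 (x, y) + h2 (x, z) + h3 (y, z)) =
        gap n (2 * x - 1) (2 * y - 1) (\<sigma> * (2 * z - 1))" for x y z
      unfolding gap_def signed by (simp add: h1_def h2_def h3_def f_def algebra_simps)
    interpret prob_space square_lebesgue by (rule prob_space_square)
    have [measurable]: "fst \<in> borel_measurable square_lebesgue" "snd \<in> borel_measurable square_lebesgue"
      by (rule unit_borel_measurable, simp)+
    have hm: "h1 \<in> borel_measurable square_lebesgue" "h2 \<in> borel_measurable square_lebesgue"
      "h3 \<in> borel_measurable square_lebesgue"
      unfolding h1_def h2_def h3_def f_def case_prod_unfold by measurable
    \<comment> \<open>The bound 5 comes from \<open>h1\<close>, a sum of five terms each at most 1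
      in absolute value.\<close>
    have int: "integrable square_lebesgue h" if "h \<in> borel_measurable square_lebesgue"
      "\<And>x y. x \<in> {0..1} \<Longrightarrow> y \<in> {0..1} \<Longrightarrow> \<bar>h (x, y)\<bar> \<le> 5" for h :: "real \<times> real \<Rightarrow> real"
      by (rule integrable_const_bound[where B = 5]) (use that in \<open>auto simp: space_square\<close>)
    have fb: "\<bar>f x y\<bar> \<le> 1" if "x \<in> {0..1}" "y \<in> {0..1}" for x y
      unfolding f_def by (rule potential_bound) (use that in auto)
    have pb: "\<bar>(2 * x - 1) * (2 * y - 1)\<bar> \<le> 1" if "x \<in> {0..1}" "y \<in> {0..1}" for x y :: real
      using that by (auto simp: abs_mult abs_le_iff intro!: mult_le_one)
    note [measurable] =
      measurable_compose[OF cube_projections_measurable(1)[OF refl] hm(1), unfolded case_prod_unfold]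
      measurable_compose[OF cube_projections_measurable(2)[OF refl] hm(2), unfolded case_prod_unfold]
      measurable_compose[OF cube_projections_measurable(3)[OF refl] hm(3), unfolded case_prod_unfold]
      product_measurable[unfolded case_prod_unfold]
    show ?thesis
    proof (rule P_lambda_comparison[OF P Q, of h1 h2 h3])
      show "integrable square_lebesgue h1"
      proof (rule int[OF hm(1)])
        show "\<bar>h1 (x, y)\<bar> \<le> 5" if "x \<in> {0..1}" "y \<in> {0..1}" for x y
          using fb[OF that] pb[OF that] that \<sigma> by (auto simp: h1_def)
      qed
      show "integrable square_lebesgue h2"
      proof (rule int[OF hm(2)])
        show "\<bar>h2 (x, y)\<bar> \<le> 5" if "x \<in> {0..1}" "y \<in> {0..1}" for x y
          using fb[OF that] pb[OF that] that \<sigma> by (auto simp: h2_def)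
      qed
      show "integrable square_lebesgue h3"
      proof (rule int[OF hm(3)])
        show "\<bar>h3 (x, y)\<bar> \<le> 5" if "x \<in> {0..1}" "y \<in> {0..1}" for x y
          using fb[OF that] pb[OF that] that \<sigma> by (auto simp: h3_def)
      qed
      show "integrable P ?k" "integrable ?Q ?k"
        by (intro integrable_mult_right P_lambda_integrable_product P Q)+
      show "h1 (x, y) + h2 (x, z) + h3 (y, z) \<le> ?k (x, y, z) + (1 / 8) ^ n"
        if "x \<in> {0..1}" "y \<in> {0..1}" "z \<in> {0..1}" for x y z
      proof -
        have "- ((1 / 8) ^ n) \<le> gap n (2 * x - 1) (2 * y - 1) (\<sigma> * (2 * z - 1))"
          by (rule gap_lower[THEN conjunct1]) (use that \<sigma> in auto)
        then show ?thesis using split[of x y z] by linarith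
      qed
      show "AE (x, y, z) in ?Q. ?k (x, y, z) \<le> h1 (x, y) + h2 (x, z) + h3 (y, z) + (1 / 8) ^ n"
      proof (subst AE_distr_iff[OF graph_measurable[OF K]])
        show "{p \<in> space cube_borel. case p of (x, y, z) \<Rightarrow>
          ?k (x, y, z) \<le> h1 (x, y) + h2 (x, z) + h3 (y, z) + (1 / 8) ^ n} \<in> sets cube_borel"
          unfolding case_prod_unfold fst_conv snd_conv by measurable
        show "AE p in square_lebesgue. case case p of (x, y) \<Rightarrow> (x, y, \<theta> (x \<oplus>\<^sub>2 y)) of
          (x, y, z) \<Rightarrow> ?k (x, y, z) \<le> h1 (x, y) + h2 (x, z) + h3 (y, z) + (1 / 8) ^ n"
        proof (rule AE_I2)
          fix p assume "p \<in> space square_lebesgue"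
          then obtain x y where p: "p = (x, y)" "x \<in> {0..1}" "y \<in> {0..1}" by (auto simp: space_square)
          then show "case case p of (x, y) \<Rightarrow> (x, y, \<theta> (x \<oplus>\<^sub>2 y)) of
            (x, y, z) \<Rightarrow> ?k (x, y, z) \<le> h1 (x, y) + h2 (x, z) + h3 (y, z) + (1 / 8) ^ n"
            using gap_upper_bitwise_add[OF p(2,3), of n] split[of x y "\<theta> (x \<oplus>\<^sub>2 y)"]
            by (simp add: \<theta>)
        qed
      qed
    qed
  qed
  \<comment> \<open>The error \<open>2 * (1 / 8) ^ n\<close> disappears as \<open>n\<close> grows,
    since neither integral depends on \<open>n\<close>.\<close>
  have "integral\<^sup>L ?Q ?k - integral\<^sup>L P ?k \<le> 2 * 0"
    by (rule LIMSEQ_le_const[OF tendsto_mult[OF tendsto_const LIMSEQ_power_zero[of "1/8::real"]]])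
      (use bound in \<open>auto simp: algebra_simps\<close>)
  then show ?thesis by simp
qed

theorem theorem5p2:
  shows "(let \<mu> = distr square_lebesgue cube_borel (\<lambda>(x, y). (x, y, 1 - (x \<oplus>\<^sub>2 y))) in
            \<mu> \<in> P_lambda \<and>
            is_arg_max (\<lambda>P. \<integral>(x, y, z). x * y * z \<partial>P) (\<lambda>P. P \<in> P_lambda) \<mu>) \<and>
         (let \<nu> = distr square_lebesgue cube_borel (\<lambda>(x, y). (x, y, x \<oplus>\<^sub>2 y)) in
            \<nu> \<in> P_lambda \<and>
            is_arg_min (\<lambda>P. \<integral>(x, y, z). x * y * z \<partial>P) (\<lambda>P. P \<in> P_lambda) \<nu>)"
proof -
  have xor: "(\<lambda>(x, y). x \<oplus>\<^sub>2 y) \<in> square_lebesgue \<rightarrow>\<^sub>M unit_lebesgue"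
    by (simp add: case_prod_unfold)
  have K: "(\<lambda>(x, y). 1 - (x \<oplus>\<^sub>2 y)) \<in> square_lebesgue \<rightarrow>\<^sub>M unit_lebesgue"
    using measurable_compose[OF xor one_minus_measurable] by (simp add: case_prod_unfold)
  have pres: "distr unit_lebesgue unit_lebesgue (\<lambda>y. 1 - (x \<oplus>\<^sub>2 y)) = unit_lebesgue" if "x \<in> {0..1}" for x
  proof -
    have "(\<lambda>y. x \<oplus>\<^sub>2 y) \<in> unit_lebesgue \<rightarrow>\<^sub>M unit_lebesgue"
      using that by (intro bitwise_add_measurable) auto
    from distr_distr[OF one_minus_measurable this] show ?thesis
      by (simp add: distr_bitwise_add[OF that] distr_one_minus comp_def)
  qed
  have max: "distr square_lebesgue cube_borel (\<lambda>(x, y). (x, y, 1 - (x \<oplus>\<^sub>2 y))) \<in> P_lambda"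
    \<comment> \<open>Commutativity transfers the invariance from the second variable to the
      first.\<close>
    by (rule graph_in_P_lambda[OF K]) (use pres in \<open>auto simp: bitwise_add_commute\<close>)
  have min: "distr square_lebesgue cube_borel (\<lambda>(x, y). (x, y, x \<oplus>\<^sub>2 y)) \<in> P_lambda"
    by (rule graph_in_P_lambda[OF xor]) (use distr_bitwise_add in \<open>auto simp: bitwise_add_commute\<close>)
  show ?thesis
    using max min xor_graph_optimal[of "- 1" "\<lambda>t. 1 - t", OF _ _ _ max K]
      xor_graph_optimal[of 1 "\<lambda>t. t", OF _ _ _ min xor]
    by (auto simp: Let_def is_arg_max_def is_arg_min_def not_less)
qed

end
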